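(* Let $G$ be a graph on $n$ vertices, $k$ a positive integer and $\mathcal{F}$ a layered family of $G$ with thickness at most $k$, with set of centers $\mathcal{C}_{\mathcal{F}}$. Then for every $X\subseteq\mathcal{C}_{\mathcal{F}}$ there exists an $(X,\frac{95}{100})$-balanced separator $S$ in $G$ such that $S$ is downward closed and $\mathrm{fcov}_{\mathcal{F}}(S)\le 5000k\cdot\log 2n\cdot\log(f+4)\cdot f$, where $f$ is the optimum value of the following linear program in nonnegative variables $x_F$ ($F\in\mathcal{F}$) and $d_{u,v}$ ($u,v\in X$): minimize $\sum_{F\in\mathcal{F}}x_F$ subject to $\sum_{v\in X}d_{u,v}\ge |X|/10$ for all $u\in X$; $d_{u,v}\le\sum_{F\in\mathcal{F},\,F\cap P\ne\emptyset}x_F$ for all $u,v\in X$ and every induced $u$--$v$ path $P$ in $G$; and $d_{u,v}\le 1$ for all $u,v\in X$.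
   Context: Logarithms are base 2. Layered family: given an ordered partition $\Pi=(L_1,\dots,L_m)$ of $V(G)$, the layer digraph has an arc $(u,v)$ iff $uv\in E(G)$, $u\in L_i$, $v\in L_j$, $j<i$. $v$ is a descendant of $u$ (and $u$ an ancestor of $v$) if there is a directed path from $u$ to $v$ (including $v=u$). For each vertex $u$ with no in-arcs, the set of $u$ and all its descendants is in $\mathcal{F}$, with center $u$; $\mathcal{C}_{\mathcal{F}}$ is the set of centers. Thickness: smallest $k$ with every member meeting at most $k$ parts. A set $S$ is downward closed if it contains every descendant of each of its vertices. An $(X,\phi)$-balanced separator is a set $S\subseteq V(G)$ such that every connected component of $G-S$ contains at most $\phi|X|$ vertices of $X$. $\mathrm{fcov}_{\mathcal{F}}(S)$ is the minimum of $\sum_F y_F$ over nonnegative $\{y_F\}$ with $\sum_{F\ni v}y_F\ge1$ for all $v\in S$. *)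

theory Defs
  imports "HOL-Analysis.Analysis" "HOL-Library.Disjoint_Sets" "Graph_Theory.Graph_Theory"
begin

text \<open>
  A finite simple undirected graph is a \<^locale>\<open>pair_graph\<close>: a finite, loopfree digraph with a
  symmetric arc set, so that \<open>uv\<close> is an edge iff \<open>(u, v) \<in> parcs G\<close>.
\<close>

definition ordered_partition :: "'a set \<Rightarrow> 'a set list \<Rightarrow> bool" where
  "ordered_partition V Ls \<longleftrightarrow> distinct Ls \<and> partition_on V (set Ls)"

definition layer_digraph :: "'a pair_pre_digraph \<Rightarrow> 'a set list \<Rightarrow> 'a pair_pre_digraph" where
  "layer_digraph G Ls =
     \<lparr>pverts = pverts G,
      parcs = {(u, v). (u, v) \<in> parcs G \<and>
                 (\<exists>i j. i < length Ls \<and> j < i \<and> u \<in> Ls ! i \<and> v \<in> Ls ! j)}\<rparr>"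

definition descendants :: "'a pair_pre_digraph \<Rightarrow> 'a set list \<Rightarrow> 'a \<Rightarrow> 'a set" where
  "descendants G Ls u = {v. u \<rightarrow>\<^sup>*\<^bsub>layer_digraph G Ls\<^esub> v}"

definition layer_centers :: "'a pair_pre_digraph \<Rightarrow> 'a set list \<Rightarrow> 'a set" where
  "layer_centers G Ls = {u \<in> pverts G. in_arcs (layer_digraph G Ls) u = {}}"

text \<open>
  A center has no proper ancestor, so distinct centers have distinct descendant sets and
  the set of sets below is indexed faithfully by its centers.
\<close>

definition layered_family :: "'a pair_pre_digraph \<Rightarrow> 'a set list \<Rightarrow> 'a set set" where
  "layered_family G Ls = descendants G Ls ` layer_centers G Ls"

definition thickness :: "'a set list \<Rightarrow> 'a set set \<Rightarrow> nat" where
  "thickness Ls \<F> = (LEAST k. \<forall>A\<in>\<F>. card {L \<in> set Ls. A \<inter> L \<noteq> {}} \<le> k)"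

definition downward_closed :: "'a pair_pre_digraph \<Rightarrow> 'a set list \<Rightarrow> 'a set \<Rightarrow> bool" where
  "downward_closed G Ls S \<longleftrightarrow> (\<forall>u\<in>S. descendants G Ls u \<subseteq> S)"

definition is_component :: "('a, 'b) pre_digraph \<Rightarrow> ('a, 'b) pre_digraph \<Rightarrow> bool" where
  "is_component H C \<longleftrightarrow> pre_digraph.max_subgraph H Digraph_Component.connected C"

definition balanced_separator :: "'a pair_pre_digraph \<Rightarrow> 'a set \<Rightarrow> real \<Rightarrow> 'a set \<Rightarrow> bool" where
  "balanced_separator G X \<phi> S \<longleftrightarrow> S \<subseteq> pverts G \<and>
     (\<forall>C. is_component (with_proj G \<restriction> (pverts G - S)) C \<longrightarrow>
          real (card (verts C \<inter> X)) \<le> \<phi> * real (card X))"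

definition fractional_cover :: "'a set set \<Rightarrow> 'a set \<Rightarrow> ('a set \<Rightarrow> real) \<Rightarrow> bool" where
  "fractional_cover \<F> S y \<longleftrightarrow> (\<forall>A\<in>\<F>. 0 \<le> y A) \<and> (\<forall>v\<in>S. (\<Sum>A\<in>{A \<in> \<F>. v \<in> A}. y A) \<ge> 1)"

definition fcov :: "'a set set \<Rightarrow> 'a set \<Rightarrow> real" where
  "fcov \<F> S = Inf {\<Sum>A\<in>\<F>. y A | y. fractional_cover \<F> S y}"

text \<open>
  Induced paths are given by their vertex sequence; for \<open>u = v\<close> the only one is \<open>[u]\<close>.
\<close>

definition induced_path :: "'a pair_pre_digraph \<Rightarrow> 'a \<Rightarrow> 'a \<Rightarrow> 'a list \<Rightarrow> bool" where
  "induced_path G u v P \<longleftrightarrow> vpath P G \<and> hd P = u \<and> last P = v \<and>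
     (\<forall>i j. i < j \<and> j < length P \<and> (P ! i, P ! j) \<in> parcs G \<longrightarrow> j = Suc i)"

definition separator_lp_feasible ::
  "'a pair_pre_digraph \<Rightarrow> 'a set set \<Rightarrow> 'a set \<Rightarrow> ('a set \<Rightarrow> real) \<Rightarrow> ('a \<Rightarrow> 'a \<Rightarrow> real) \<Rightarrow> bool" where
  "separator_lp_feasible G \<F> X x d \<longleftrightarrow>
     (\<forall>A\<in>\<F>. 0 \<le> x A) \<and>
     (\<forall>u\<in>X. \<forall>v\<in>X. 0 \<le> d u v) \<and>
     (\<forall>u\<in>X. (\<Sum>v\<in>X. d u v) \<ge> real (card X) / 10) \<and>
     (\<forall>u\<in>X. \<forall>v\<in>X. \<forall>P. induced_path G u v P \<longrightarrow>
        d u v \<le> (\<Sum>A\<in>{A \<in> \<F>. A \<inter> set P \<noteq> {}}. x A)) \<and>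
     (\<forall>u\<in>X. \<forall>v\<in>X. d u v \<le> 1)"

definition separator_lp_opt :: "'a pair_pre_digraph \<Rightarrow> 'a set set \<Rightarrow> 'a set \<Rightarrow> real" where
  "separator_lp_opt G \<F> X = Inf {\<Sum>A\<in>\<F>. x A | x d. separator_lp_feasible G \<F> X x d}"

text \<open>
  For layered families both infima are attained, i.e. they are minima.
\<close>

lemma Inf_eq_attained:
  fixes m :: real
  assumes "m \<in> R" "\<And>r. r \<in> R \<Longrightarrow> m \<le> r"
  shows "Inf R = m"
  using assms by (meson cInf_eq_minimum)

lemma compact_box_fun:
  fixes K :: "'b::topological_space set"
  assumes "compact K"
  shows "compact {f :: 'i \<Rightarrow> 'b. \<forall>i. f i \<in> K}"
proof -
  have "compactin (product_topology (\<lambda>_. euclidean) UNIV) (PiE (UNIV :: 'i set) (\<lambda>_. K))"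
    using assms by (subst compactin_PiE) (auto simp: compactin_euclidean_iff)
  moreover have "PiE (UNIV :: 'i set) (\<lambda>_. K) = {f. \<forall>i. f i \<in> K}"
    by (auto simp: PiE_def)
  ultimately show ?thesis
    by (simp add: euclidean_product_topology compactin_euclidean_iff)
qed

lemma fcov_attained:
  assumes fin: "finite \<F>" and cov: "S \<subseteq> \<Union>\<F>"
  shows "\<exists>y. fractional_cover \<F> S y \<and> (\<Sum>A\<in>\<F>. y A) = fcov \<F> S"
proof -
  define B where "B = real (card \<F>)"
  define K where "K = {y. \<forall>A. y A \<in> {0..max 1 B}} \<inter> {y. fractional_cover \<F> S y}"
  have "closed {y. fractional_cover \<F> S y}"
    unfolding fractional_cover_def Ball_def
    by (intro closed_Collect_conj closed_Collect_all closed_Collect_imp closed_Collect_le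
          open_Collect_const continuous_on_const continuous_on_sum
          continuous_on_product_coordinates)
  then have "compact K"
    unfolding K_def by (intro compact_Int_closed compact_box_fun) auto
  moreover have one: "(\<lambda>_. 1) \<in> K"
  proof -
    have "1 \<le> (\<Sum>A\<in>{A \<in> \<F>. v \<in> A}. 1::real)" if "v \<in> S" for v
    proof -
      from cov that have "{A \<in> \<F>. v \<in> A} \<noteq> {}" by auto
      with fin show ?thesis by (simp add: Suc_le_eq card_gt_0_iff)
    qed
    then show ?thesis by (simp add: K_def fractional_cover_def)
  qed
  moreover have "continuous_on K (\<lambda>y. \<Sum>A\<in>\<F>. y A)"
    by (intro continuous_on_sum continuous_on_subset[OF continuous_on_product_coordinates]) auto
  ultimately obtain y where y: "y \<in> K" "\<And>z. z \<in> K \<Longrightarrow> (\<Sum>A\<in>\<F>. y A) \<le> (\<Sum>A\<in>\<F>. z A)"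
    using continuous_attains_inf[of K "\<lambda>y. \<Sum>A\<in>\<F>. y A"] by blast
  have "(\<Sum>A\<in>\<F>. y A) \<le> (\<Sum>A\<in>\<F>. z A)" if z: "fractional_cover \<F> S z" for z
  proof (cases "(\<Sum>A\<in>\<F>. z A) \<le> B")
    case True
    define z' where "z' = (\<lambda>A. if A \<in> \<F> then z A else 0)"
    have "z A \<le> max 1 B" if "A \<in> \<F>" for A
      using member_le_sum[of A \<F> z] True that fin z by (auto simp: fractional_cover_def)
    then have "z' \<in> K"
      using z by (auto simp: K_def z'_def fractional_cover_def)
    from y(2)[OF this] show ?thesis by (simp add: z'_def)
  next
    case False
    then show ?thesis using y(2)[OF one] by (simp add: B_def)
  qed
  then have "fcov \<F> S = (\<Sum>A\<in>\<F>. y A)"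
    unfolding fcov_def using y(1) by (intro Inf_eq_attained) (auto simp: K_def)
  with y(1) show ?thesis by (auto simp: K_def)
qed

lemma separator_lp_opt_attained:
  assumes fin: "finite \<F>" and cov: "pverts G \<subseteq> \<Union>\<F>"
  shows "\<exists>x d. separator_lp_feasible G \<F> X x d \<and> (\<Sum>A\<in>\<F>. x A) = separator_lp_opt G \<F> X"
proof -
  define B where "B = real (card \<F>)"
  define K where "K = ({x. \<forall>A. x A \<in> {0..max 1 B}} \<times> {d. \<forall>u. d u \<in> {e. \<forall>v. e v \<in> {0..1::real}}})
    \<inter> {p. separator_lp_feasible G \<F> X (fst p) (snd p)}"
  have c1: "continuous_on T (\<lambda>p. fst p A)" for A
    and T :: "(('a set \<Rightarrow> real) \<times> ('a \<Rightarrow> 'a \<Rightarrow> real)) set"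
    by (rule continuous_on_product_then_coordinatewise, rule continuous_on_fst, rule continuous_on_id)
  have c2: "continuous_on T (\<lambda>p. snd p u v)" for u v
    and T :: "(('a set \<Rightarrow> real) \<times> ('a \<Rightarrow> 'a \<Rightarrow> real)) set"
    by (rule continuous_on_product_then_coordinatewise, rule continuous_on_product_then_coordinatewise,
        rule continuous_on_snd, rule continuous_on_id)
  have "closed {p. separator_lp_feasible G \<F> X (fst p) (snd p)}"
    unfolding separator_lp_feasible_def Ball_def
    by (intro closed_Collect_conj closed_Collect_all closed_Collect_imp closed_Collect_le
          open_Collect_const continuous_on_const continuous_on_sum c1 c2)
  then have "compact K"
    unfolding K_def by (intro compact_Int_closed compact_Times compact_box_fun) auto
  moreover have one: "(\<lambda>_. 1, \<lambda>_ _. 1) \<in> K"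
  proof -
    have "1 \<le> (\<Sum>A\<in>{A \<in> \<F>. A \<inter> set P \<noteq> {}}. 1::real)" if "induced_path G u v P" for u v P
    proof -
      have "P \<noteq> []" "set P \<subseteq> pverts G"
        using that by (auto simp: induced_path_def vpath_def vwalk_def)
      then have "hd P \<in> set P" "hd P \<in> pverts G" by auto
      with cov have "{A \<in> \<F>. A \<inter> set P \<noteq> {}} \<noteq> {}" by blast
      with fin show ?thesis by (simp add: Suc_le_eq card_gt_0_iff)
    qed
    then show ?thesis by (auto simp: K_def separator_lp_feasible_def)
  qed
  moreover have "continuous_on K (\<lambda>p. \<Sum>A\<in>\<F>. fst p A)"
    by (intro continuous_on_sum c1)
  ultimately obtain p where p: "p \<in> K" "\<And>q. q \<in> K \<Longrightarrow> (\<Sum>A\<in>\<F>. fst p A) \<le> (\<Sum>A\<in>\<F>. fst q A)"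
    using continuous_attains_inf[of K "\<lambda>p. \<Sum>A\<in>\<F>. fst p A"] by blast
  have "(\<Sum>A\<in>\<F>. fst p A) \<le> (\<Sum>A\<in>\<F>. x A)" if f: "separator_lp_feasible G \<F> X x d" for x d
  proof (cases "(\<Sum>A\<in>\<F>. x A) \<le> B")
    case True
    define x' where "x' = (\<lambda>A. if A \<in> \<F> then x A else 0)"
    define d' where "d' = (\<lambda>u v. if u \<in> X \<and> v \<in> X then d u v else 0)"
    have xB: "x A \<le> max 1 B" if "A \<in> \<F>" for A
      using member_le_sum[of A \<F> x] True that fin f by (auto simp: separator_lp_feasible_def)
    have "(\<Sum>v\<in>X. d' u v) = (\<Sum>v\<in>X. d u v)" if "u \<in> X" for u
      using that by (simp add: d'_def)
    moreover have "(\<Sum>A\<in>{A \<in> \<F>. Q A}. x' A) = (\<Sum>A\<in>{A \<in> \<F>. Q A}. x A)" for Q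
      by (rule sum.cong) (auto simp: x'_def)
    ultimately have "separator_lp_feasible G \<F> X x' d'"
      using f unfolding separator_lp_feasible_def by (simp add: x'_def d'_def)
    moreover have "x' A \<in> {0..max 1 B}" "d' u v \<in> {0..1}" for A u v
      using f xB[of A] by (auto simp: x'_def d'_def separator_lp_feasible_def)
    ultimately have "(x', d') \<in> K"
      by (auto simp: K_def)
    from p(2)[OF this] show ?thesis by (simp add: x'_def)
  next
    case False
    then show ?thesis using p(2)[OF one] by (simp add: B_def)
  qed
  then have "separator_lp_opt G \<F> X = (\<Sum>A\<in>\<F>. fst p A)"
    unfolding separator_lp_opt_def using p(1) by (intro Inf_eq_attained) (auto simp: K_def)
  with p(1) show ?thesis by (auto simp: K_def)
qed

lemma layered_family_covers:
  assumes "ordered_partition (pverts G) Ls"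
  shows "pverts G \<subseteq> \<Union>(layered_family G Ls)"
proof
  fix v assume v: "v \<in> pverts G"
  let ?D = "with_proj (layer_digraph G Ls)"
  define Q where "Q = (\<lambda>i. \<exists>u\<in>pverts G. i < length Ls \<and> u \<in> Ls ! i \<and> u \<rightarrow>\<^sup>*\<^bsub>?D\<^esub> v)"
  have VD: "verts ?D = pverts G" by (simp add: layer_digraph_def)
  have layer: "\<exists>i<length Ls. u \<in> Ls ! i" if "u \<in> pverts G" for u
    using assms that unfolding ordered_partition_def partition_on_def
    by (metis UnionE in_set_conv_nth)
  have refl: "v \<rightarrow>\<^sup>*\<^bsub>?D\<^esub> v" using v VD by (simp add: reachable_def rtrancl_on_refl)
  have ex: "\<exists>i. Q i" using layer[OF v] v refl by (auto simp: Q_def)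
  have bd: "\<And>i. Q i \<Longrightarrow> i \<le> length Ls" by (auto simp: Q_def)
  define i where "i = (GREATEST i. Q i)"
  have "Q i" using ex bd unfolding i_def by (metis GreatestI_nat)
  then obtain u where u: "u \<in> pverts G" "i < length Ls" "u \<in> Ls ! i" "u \<rightarrow>\<^sup>*\<^bsub>?D\<^esub> v"
    by (auto simp: Q_def)
  have "in_arcs ?D u = {}"
  proof (rule ccontr)
    assume "in_arcs ?D u \<noteq> {}"
    then obtain w where w: "(w, u) \<in> parcs (layer_digraph G Ls)"
      by (auto simp: in_arcs_def)
    then obtain a b where ab: "a < length Ls" "b < a" "w \<in> Ls ! a" "u \<in> Ls ! b"
      by (auto simp: layer_digraph_def)
    have "b = i"
    proof (rule ccontr)
      assume "b \<noteq> i"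
      then have "Ls ! b \<noteq> Ls ! i" "Ls ! b \<in> set Ls" "Ls ! i \<in> set Ls"
        using assms ab u by (auto simp: ordered_partition_def nth_eq_iff_index_eq)
      then have "Ls ! b \<inter> Ls ! i = {}"
        using assms by (auto simp: ordered_partition_def partition_on_def disjoint_def)
      with ab u show False by auto
    qed
    have "w \<in> pverts G"
      using assms ab by (auto simp: ordered_partition_def partition_on_def)
    moreover from this have "w \<rightarrow>\<^sup>*\<^bsub>?D\<^esub> v"
    proof -
      have "(w, u) \<in> arcs_ends ?D"
        using w by (force simp: arcs_ends_def arc_to_ends_def)
      with \<open>w \<in> pverts G\<close> u(4) VD show ?thesis
        unfolding reachable_def by (metis converse_rtrancl_on_into_rtrancl_on)
    qed
    ultimately have "Q a" using ab by (auto simp: Q_def)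
    then have "a \<le> i" unfolding i_def using bd by (rule Greatest_le_nat)
    with ab \<open>b = i\<close> show False by simp
  qed
  with u show "v \<in> \<Union>(layered_family G Ls)"
    by (auto simp: layered_family_def layer_centers_def descendants_def)
qed

lemma finite_layered_family:
  assumes "pair_graph G"
  shows "finite (layered_family G Ls)"
proof -
  interpret pair_graph G by fact
  show ?thesis by (simp add: layered_family_def layer_centers_def)
qed

end

theory Submission
  imports Defs
begin

text \<open>
  Region growing. Spread an extra mass \<open>f / n\<close> over every member of \<open>\<F>\<close>, so that the weight of a
  vertex (the mass of the members containing it) is at least \<open>f / n\<close>, and delete all vertices of
  weight at least \<open>\<theta>\<close>, which costs \<open>2 f / \<theta>\<close>. As long as a component \<open>H\<close> with more than \<open>95%\<close> of
  \<open>X\<close> remains, measure the distance of a vertex from some \<open>u \<in> X \<inter> H\<close> by the least mass of the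
  members met by a connected subset of \<open>H\<close> joining the two. Along an arc \<open>v \<rightarrow> w\<close> of the layer digraph
  both \<open>nd v \<le> nd w\<close> and \<open>nd w - wt w \<le> nd v - wt v\<close> hold, because every member containing \<open>v\<close>
  contains \<open>w\<close>. Hence the sphere \<open>{v. nd v - wt v \<le> r < nd v}\<close> is downward closed outside the
  deleted set, and a member \<open>A\<close> meeting the sphere in \<open>v\<close> has its center at distance at most \<open>wt v\<close>
  from \<open>r\<close>. So the sphere is covered by giving \<open>A\<close> about \<open>z A / max (f / n) \<bar>r - nd (cen A)\<bar>\<close>,
  whose average over \<open>r\<close> in a ring of width \<open>W\<close> is \<open>O(log n / W)\<close> times the mass centered in the
  ring. Among \<open>O(log (f + 4))\<close> concentric rings, one contains no more mass than the ball inside it,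
  and that ball pays for the cut. The ball has at most \<open>95%\<close> of \<open>X\<close> by the constraints on \<open>d\<close>, so it
  is never charged again.
\<close>

section \<open>Connected vertex sets\<close>

definition connected_set :: "('a \<times> 'a) set \<Rightarrow> 'a set \<Rightarrow> bool" where
  "connected_set E B \<longleftrightarrow> (\<forall>a\<in>B. \<forall>b\<in>B. (a, b) \<in> (E \<inter> B \<times> B)\<^sup>*)"

lemma connected_set_singleton: "connected_set E {a}"
  by (simp add: connected_set_def)

lemma connected_set_insert:
  assumes "connected_set E B" "v \<in> B" "(v, w) \<in> E" "(w, v) \<in> E"
  shows "connected_set E (insert w B)"
proof -
  let ?Q = "(E \<inter> insert w B \<times> insert w B)\<^sup>*"
  have sub: "(a, b) \<in> ?Q" if "a \<in> B" "b \<in> B" for a b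
    using assms(1) that rtrancl_mono[of "E \<inter> B \<times> B" "E \<inter> insert w B \<times> insert w B"]
    unfolding connected_set_def by blast
  have 1: "(w, v) \<in> ?Q" "(v, w) \<in> ?Q"
    using assms by auto
  have "(a, v) \<in> ?Q \<and> (v, a) \<in> ?Q" if "a \<in> insert w B" for a
    using that sub[OF _ assms(2)] sub[OF assms(2)] 1 by auto
  then show ?thesis
    unfolding connected_set_def by (meson rtrancl_trans)
qed

text \<open>Used to trap a connected set inside \<open>Z\<close>. Contrapositively, a connected set
  that meets \<open>Z\<close> without lying in it has an edge leaving \<open>Z\<close>.\<close>

lemma connected_set_subset_closed:
  assumes "connected_set E B" "b \<in> B" "b \<in> Z"
    and "\<And>v w. v \<in> B \<Longrightarrow> w \<in> B \<Longrightarrow> (v, w) \<in> E \<Longrightarrow> v \<in> Z \<Longrightarrow> w \<in> Z"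
  shows "B \<subseteq> Z"
proof
  fix a assume "a \<in> B"
  then have "(b, a) \<in> (E \<inter> B \<times> B)\<^sup>*"
    using assms by (auto simp: connected_set_def)
  then show "a \<in> Z"
    by (induction) (use assms in auto)
qed

lemma connected_set_exists_component:
  assumes "sym E" "connected_set E B" "B \<subseteq> U" "b \<in> B"
  obtains H where "connected_set E H" "B \<subseteq> H" "H \<subseteq> U"
    "\<And>v w. v \<in> H \<Longrightarrow> (v, w) \<in> E \<Longrightarrow> w \<in> U \<Longrightarrow> w \<in> H"
proof -
  define H where "H = {v. (b, v) \<in> (E \<inter> U \<times> U)\<^sup>*}"
  have bH: "b \<in> H" by (simp add: H_def)
  have cl: "w \<in> H" if "v \<in> H" "(v, w) \<in> E" "w \<in> U" "v \<in> U" for v w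
    using that unfolding H_def by (auto intro: rtrancl_into_rtrancl)
  have HU: "H \<subseteq> U"
  proof
    fix v assume "v \<in> H"
    then have "(b, v) \<in> (E \<inter> U \<times> U)\<^sup>*" by (simp add: H_def)
    then show "v \<in> U" by (induction) (use assms in auto)
  qed
  have BH: "B \<subseteq> H"
    by (rule connected_set_subset_closed[OF assms(2,4) bH]) (use cl assms in auto)
  \<comment> \<open>A walk from \<open>b\<close> inside \<open>U\<close> never leaves
    \<open>H\<close>, because each of its prefixes ends in \<open>H\<close>.\<close>
  have from_b: "(b, v) \<in> (E \<inter> H \<times> H)\<^sup>*" if "v \<in> H" for v
  proof -
    have "(b, v) \<in> (E \<inter> U \<times> U)\<^sup>*" using that by (simp add: H_def)
    then show ?thesis
    proof induction
      case (step y z)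
      then have "y \<in> H" "z \<in> H" by (auto simp: H_def intro: rtrancl_into_rtrancl)
      with step show ?case by (auto intro: rtrancl_into_rtrancl)
    qed simp
  qed
  have "sym (E \<inter> H \<times> H)" using assms(1) by (auto simp: sym_def)
  then have "sym ((E \<inter> H \<times> H)\<^sup>*)" by (rule sym_rtrancl)
  with from_b have "connected_set E H"
    unfolding connected_set_def by (meson rtrancl_trans symD)
  with BH HU cl that show ?thesis by blast
qed

lemma sum_union_le:
  fixes z :: "'b \<Rightarrow> real"
  assumes "finite A" "finite B" "\<And>a. a \<in> A \<inter> B \<Longrightarrow> 0 \<le> z a"
  shows "sum z (A \<union> B) \<le> sum z A + sum z B"
  using assms sum_nonneg[of "A \<inter> B" z] by (simp add: sum_Un)

section \<open>Families of cones\<close>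

text \<open>A layered family seen abstractly: \<open>R\<close> is the arc set of the layer digraph,
  and every member is the cone below its center. The bound \<open>card_F\<close> keeps the mass f /
  n added to each member at most f in total.\<close>

locale cone_family =
  fixes V :: "'a set" and E R :: "('a \<times> 'a) set" and \<F> :: "'a set set" and cen :: "'a set \<Rightarrow> 'a"
  assumes finite_V: "finite V" and E_sub: "E \<subseteq> V \<times> V" and sym_E: "sym E" and R_sub: "R \<subseteq> E"
    and finite_F: "finite \<F>" and cen_V: "A \<in> \<F> \<Longrightarrow> cen A \<in> V"
    and cone: "A \<in> \<F> \<Longrightarrow> A = R\<^sup>* `` {cen A}"
    and covers: "V \<subseteq> \<Union>\<F>" and card_F: "card \<F> \<le> card V"
begin

text \<open>A member met several times counts once, as in the path constraints of the linear
  program.\<close>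

definition mass :: "('a set \<Rightarrow> real) \<Rightarrow> 'a set \<Rightarrow> real" where
  "mass z B = (\<Sum>A | A \<in> \<F> \<and> A \<inter> B \<noteq> {}. z A)"

definition wt :: "('a set \<Rightarrow> real) \<Rightarrow> 'a \<Rightarrow> real" where
  "wt z v = (\<Sum>A | A \<in> \<F> \<and> v \<in> A. z A)"

lemma cone_closed: "A \<in> \<F> \<Longrightarrow> v \<in> A \<Longrightarrow> (v, w) \<in> R \<Longrightarrow> w \<in> A"
  using cone by (metis Image_singleton_iff rtrancl_into_rtrancl)

lemma mass_mono:
  assumes "\<And>A. A \<in> \<F> \<Longrightarrow> 0 \<le> z A" "B \<subseteq> C" shows "mass z B \<le> mass z C"
  unfolding mass_def using assms finite_F by (intro sum_mono2) auto

lemma mass_mono_weight: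
  assumes "\<And>A. A \<in> \<F> \<Longrightarrow> z A \<le> z' A" shows "mass z B \<le> mass z' B"
  unfolding mass_def using assms by (intro sum_mono) auto

lemma mass_le_total:
  assumes "\<And>A. A \<in> \<F> \<Longrightarrow> 0 \<le> z A" shows "mass z B \<le> (\<Sum>A\<in>\<F>. z A)"
  unfolding mass_def using assms finite_F by (intro sum_mono2) auto

lemma mass_singleton: "mass z {v} = wt z v"
  unfolding mass_def wt_def by (rule sum.cong) auto

lemma mass_insert_le:
  assumes "\<And>A. A \<in> \<F> \<Longrightarrow> 0 \<le> z A"
  shows "mass z (insert w B) \<le> mass z B + wt z w"
proof -
  have "mass z (insert w B) = sum z ({A \<in> \<F>. A \<inter> B \<noteq> {}} \<union> {A \<in> \<F>. w \<in> A})"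
    unfolding mass_def by (rule sum.cong) auto
  also have "\<dots> \<le> mass z B + wt z w"
    unfolding mass_def wt_def using finite_F assms by (intro sum_union_le) auto
  finally show ?thesis .
qed

lemma wt_mono:
  assumes "\<And>A. A \<in> \<F> \<Longrightarrow> 0 \<le> z A" "(v, w) \<in> R" shows "wt z v \<le> wt z w"
  unfolding wt_def using assms finite_F cone_closed by (intro sum_mono2) auto

text \<open>Members containing \<open>v\<close> meet \<open>B\<close> already, so only those
  containing \<open>w\<close> but not \<open>v\<close> can be new. As every member containing
  \<open>v\<close> contains \<open>w\<close>, their mass is \<open>wt z w - wt z v\<close>.\<close>

lemma mass_insert_descendant_le:
  assumes z: "\<And>A. A \<in> \<F> \<Longrightarrow> 0 \<le> z A" and vw: "v \<in> B" "(v, w) \<in> R"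
  shows "mass z (insert w B) \<le> mass z B + (wt z w - wt z v)"
proof -
  let ?D = "{A \<in> \<F>. w \<in> A} - {A \<in> \<F>. v \<in> A}"
  have "mass z (insert w B) \<le> sum z ({A \<in> \<F>. A \<inter> B \<noteq> {}} \<union> ?D)"
    unfolding mass_def using z finite_F vw by (intro sum_mono2) auto
  also have "\<dots> \<le> mass z B + sum z ?D"
    unfolding mass_def using finite_F z by (intro sum_union_le) auto
  also have "sum z ?D = wt z w - wt z v"
    unfolding wt_def using finite_F cone_closed vw by (intro sum_diff) auto
  finally show ?thesis .
qed

text \<open>A member containing \<open>v\<close> also contains \<open>w\<close>, hence meets
  \<open>B\<close> already.\<close>

lemma mass_insert_ancestor:
  assumes "w \<in> B" "(v, w) \<in> R"
  shows "mass z (insert v B) = mass z B"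
  unfolding mass_def using assms cone_closed by (intro sum.cong) auto

end

section \<open>Growing balls\<close>

locale ball_growing = cone_family +
  fixes z :: "'a set \<Rightarrow> real" and S H :: "'a set" and u :: 'a
  assumes z_nonneg: "A \<in> \<F> \<Longrightarrow> 0 \<le> z A"
    and S_closed: "(v, w) \<in> R \<Longrightarrow> v \<in> S \<Longrightarrow> w \<in> S"
    and H_conn: "connected_set E H" and H_sub: "H \<subseteq> V - S"
    and H_comp: "v \<in> H \<Longrightarrow> (v, w) \<in> E \<Longrightarrow> w \<in> V - S \<Longrightarrow> w \<in> H"
    and u_H: "u \<in> H"
begin

text \<open>Connected sets replace paths, so a joining set can be extended by a neighbour without
  regard to repeated vertices.\<close>

definition joining :: "'a \<Rightarrow> 'a set set" where
  "joining v = {B. B \<subseteq> H \<and> connected_set E B \<and> u \<in> B \<and> v \<in> B}"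

definition nd :: "'a \<Rightarrow> real" where
  "nd v = Min (mass z ` joining v)"

lemma finite_joining: "finite (joining v)"
proof -
  have "finite H" using H_sub finite_V by (metis finite_Diff finite_subset)
  then show ?thesis unfolding joining_def by (rule rev_finite_subset[OF iffD2[OF finite_Pow_iff]]) auto
qed

lemma nd_le: "B \<in> joining v \<Longrightarrow> nd v \<le> mass z B"
  unfolding nd_def using finite_joining by (intro Min_le) auto

lemma nd_attained:
  assumes "v \<in> H"
  obtains B where "B \<in> joining v" "nd v = mass z B"
proof -
  have "H \<in> joining v" using assms H_conn u_H by (auto simp: joining_def)
  then have "mass z ` joining v \<noteq> {}" by auto
  then have "nd v \<in> mass z ` joining v"
    unfolding nd_def using finite_joining by (intro Min_in) auto
  with that show ?thesis by auto
qed

lemma joining_insert: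
  assumes "B \<in> joining v" "(v, w) \<in> E" "w \<in> H"
  shows "insert w B \<in> joining w"
  using assms sym_E connected_set_insert[of E B v w] by (auto simp: joining_def dest: symD)

lemma nd_edge_le:
  assumes "v \<in> H" "w \<in> H" "(v, w) \<in> E"
  shows "nd w \<le> nd v + wt z w"
proof -
  obtain B where B: "B \<in> joining v" "nd v = mass z B" using nd_attained assms by blast
  have "nd w \<le> mass z (insert w B)" using nd_le joining_insert B assms by blast
  also have "\<dots> \<le> mass z B + wt z w" using z_nonneg by (rule mass_insert_le)
  finally show ?thesis using B by simp
qed

lemma nd_root_le: "nd u \<le> wt z u"
proof -
  have "{u} \<in> joining u" using u_H connected_set_singleton by (auto simp: joining_def)
  then show ?thesis using nd_le mass_singleton by metis
qed

text \<open>The tail lies in \<open>H\<close> because \<open>S\<close> is closed under arcs. For the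
  inequalities, insert one end into an optimal joining set of the other: the ancestor is free, and
  the descendant costs at most \<open>wt z w - wt z v\<close>.\<close>

lemma nd_arc:
  assumes "w \<in> H" "(v, w) \<in> R"
  shows "v \<in> H" "nd v \<le> nd w" "nd w - wt z w \<le> nd v - wt z v"
proof -
  have E: "(v, w) \<in> E" "(w, v) \<in> E" using assms R_sub sym_E by (auto dest: symD)
  have "v \<notin> S" using S_closed assms H_sub by blast
  then show v: "v \<in> H" using E H_comp[of w v] E_sub assms by auto
  obtain B where B: "B \<in> joining w" "nd w = mass z B" using nd_attained assms by blast
  have "nd v \<le> mass z (insert v B)" using nd_le joining_insert[OF B(1) E(2) v] by blast
  also have "\<dots> = mass z B"
    using B assms by (intro mass_insert_ancestor) (auto simp: joining_def)
  finally show "nd v \<le> nd w" using B by simp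
  obtain C where C: "C \<in> joining v" "nd v = mass z C" using nd_attained v by blast
  have "nd w \<le> mass z (insert w C)" using nd_le joining_insert[OF C(1) E(1) assms(1)] by blast
  also have "\<dots> \<le> mass z C + (wt z w - wt z v)"
    using C assms z_nonneg by (intro mass_insert_descendant_le) (auto simp: joining_def)
  finally show "nd w - wt z w \<le> nd v - wt z v" using C by simp
qed

lemma wt_nonneg: "0 \<le> wt z v"
  unfolding wt_def using z_nonneg by (intro sum_nonneg) auto

text \<open>Along a directed path from the center to \<open>w\<close>, \<open>nd\<close> does not
  decrease and \<open>nd\<close> minus \<open>wt\<close> does not increase.\<close>

lemma nd_cen:
  assumes "A \<in> \<F>" "w \<in> A" "w \<in> H"
  shows "cen A \<in> H" "nd (cen A) \<le> nd w" "nd w \<le> nd (cen A) + wt z w"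
proof -
  have "(cen A, w) \<in> R\<^sup>*" using cone assms by blast
  then have "cen A \<in> H \<and> nd (cen A) \<le> nd w \<and> nd w - wt z w \<le> nd (cen A) - wt z (cen A)"
  proof (induction rule: converse_rtrancl_induct)
    case (step y x)
    then show ?case using nd_arc[of x y] by linarith
  qed (use assms in auto)
  then show "cen A \<in> H" "nd (cen A) \<le> nd w" "nd w \<le> nd (cen A) + wt z w"
    using wt_nonneg[of "cen A"] by linarith+
qed

text \<open>Members are counted by their centers, so that disjoint balls own disjoint sets of
  members.\<close>

definition ballvol :: "real \<Rightarrow> real" where
  "ballvol t = (\<Sum>A | A \<in> \<F> \<and> cen A \<in> H \<and> nd (cen A) \<le> t. z A)"

lemma ballvol_le_total: "ballvol t \<le> (\<Sum>A\<in>\<F>. z A)"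
  unfolding ballvol_def using z_nonneg finite_F by (intro sum_mono2) auto

text \<open>An optimal joining set of \<open>v\<close> also joins each of its own vertices to
  \<open>u\<close>. By \<open>nd_cen\<close>, every member it meets therefore has its center within
  distance \<open>nd v\<close>.\<close>

lemma nd_le_ballvol:
  assumes "v \<in> H" "nd v \<le> t"
  shows "nd v \<le> ballvol t"
proof -
  obtain B where B: "B \<in> joining v" "nd v = mass z B" using nd_attained assms by blast
  have "cen A \<in> H \<and> nd (cen A) \<le> t" if A: "A \<in> \<F>" "A \<inter> B \<noteq> {}" for A
  proof -
    obtain b where b: "b \<in> A" "b \<in> B" using A by blast
    then have "nd b \<le> nd v" using B nd_le[of B b] by (auto simp: joining_def)
    moreover have "b \<in> H" using b B by (auto simp: joining_def)
    ultimately show ?thesis using nd_cen[of A b] A b assms by auto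
  qed
  then have "mass z B \<le> ballvol t"
    unfolding mass_def ballvol_def using z_nonneg finite_F by (intro sum_mono2) auto
  with B show ?thesis by simp
qed

text \<open>Since \<open>H\<close> is connected and reaches beyond \<open>a\<close>, some edge
  crosses this distance. It climbs by less than \<open>\<theta>\<close>, so its inner end is farther
  than \<open>a - \<theta>\<close>, and \<open>nd_le_ballvol\<close> applies to that end.\<close>

lemma ballvol_lower:
  assumes wt: "\<And>v. v \<in> V - S \<Longrightarrow> wt z v < \<theta>" and "\<theta> \<le> a"
    and far: "w \<in> H" "a < nd w"
  shows "a - \<theta> < ballvol a"
proof -
  have "nd u \<le> a" using nd_root_le wt[of u] u_H H_sub assms(2) by fastforce
  then have "\<not> H \<subseteq> {v. nd v \<le> a}" "u \<in> {v. nd v \<le> a}" using far by auto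
  with connected_set_subset_closed[OF H_conn u_H, of "{v. nd v \<le> a}"]
  obtain x y where xy: "x \<in> H" "y \<in> H" "(x, y) \<in> E" "nd x \<le> a" "\<not> nd y \<le> a"
    unfolding mem_Collect_eq by metis
  then have "nd y \<le> nd x + wt z y" using nd_edge_le by blast
  then have "a - \<theta> < nd x" using xy wt[of y] H_sub by fastforce
  also have "nd x \<le> ballvol a" using nd_le_ballvol xy by blast
  finally show ?thesis .
qed

end

section \<open>Choice of a ring and of a radius\<close>

lemma exists_non_doubling:
  fixes U :: "nat \<Rightarrow> real"
  assumes "c < U 0" "U T \<le> 2 ^ T * c"
  shows "\<exists>j<T. U (Suc j) \<le> 2 * U j"
proof (rule ccontr)
  assume "\<not> ?thesis"
  then have *: "2 * U j < U (Suc j)" if "j < T" for j using that by auto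
  have "2 ^ j * c < U j" if "j \<le> T" for j
    using that
  proof (induction j)
    case (Suc j)
    then show ?case using *[of j] by simp
  qed (use assms in simp)
  from this[of T] show False using assms by simp
qed

text \<open>
  The weight function is the derivative of \<open>2 arsinh (t / \<delta>)\<close>, a smooth substitute for
  \<open>2 / max \<delta> \<bar>t\<bar>\<close>, so the mean value theorem does the averaging over \<open>r\<close>.
\<close>

lemma exists_cheap_radius:
  fixes x p :: "'i \<Rightarrow> real"
  assumes "finite I" and x: "\<And>i. i \<in> I \<Longrightarrow> 0 \<le> x i" and p: "\<And>i. i \<in> I \<Longrightarrow> p i \<in> {a..b}"
    and "0 < \<delta>" "a \<le> \<alpha>" "\<alpha> < \<beta>" "\<beta> \<le> b"
  obtains r where "\<alpha> < r" "r < \<beta>"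
    "(\<Sum>i\<in>I. x i * (2 / (\<delta> * sqrt (((r - p i) / \<delta>)\<^sup>2 + 1))))
      \<le> 4 * arsinh ((b - a) / \<delta>) / (\<beta> - \<alpha>) * sum x I"
proof -
  define \<Phi> where "\<Phi> r = (\<Sum>i\<in>I. x i * (2 * arsinh ((r - p i) / \<delta>)))" for r
  define \<phi> where "\<phi> r = (\<Sum>i\<in>I. x i * (2 / (\<delta> * sqrt (((r - p i) / \<delta>)\<^sup>2 + 1))))" for r
  have "(\<Phi> has_real_derivative \<phi> r) (at r)" for r
    unfolding \<Phi>_def \<phi>_def
  proof (rule DERIV_sum)
    fix i
    have "((\<lambda>r. (r - p i) / \<delta>) has_real_derivative 1 / \<delta>) (at r)"
      using assms(4) by (auto intro!: derivative_eq_intros)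
    from DERIV_chain2[OF arsinh_real_has_field_derivative this]
    have "((\<lambda>r. arsinh ((r - p i) / \<delta>)) has_real_derivative
        1 / (\<delta> * sqrt (((r - p i) / \<delta>)\<^sup>2 + 1))) (at r)"
      by (simp add: mult.commute)
    from DERIV_cmult[OF DERIV_cmult[OF this, of 2], of "x i"]
    show "((\<lambda>r. x i * (2 * arsinh ((r - p i) / \<delta>))) has_real_derivative
        x i * (2 / (\<delta> * sqrt (((r - p i) / \<delta>)\<^sup>2 + 1)))) (at r)"
      by simp
  qed
  from MVT2[OF \<open>\<alpha> < \<beta>\<close> this] obtain r where r: "\<alpha> < r" "r < \<beta>" "\<Phi> \<beta> - \<Phi> \<alpha> = (\<beta> - \<alpha>) * \<phi> r"
    by auto
  have "\<Phi> \<beta> - \<Phi> \<alpha> = (\<Sum>i\<in>I. x i * (2 * arsinh ((\<beta> - p i) / \<delta>) - 2 * arsinh ((\<alpha> - p i) / \<delta>)))"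
    by (simp add: \<Phi>_def sum_subtractf right_diff_distrib)
  \<comment> \<open>All of \<open>\<alpha>\<close>, \<open>\<beta>\<close> and \<open>p i\<close>
    lie between \<open>a\<close> and \<open>b\<close>, so both arguments are at most
    \<open>(b - a) / \<delta>\<close> in absolute value; \<open>arsinh\<close> is odd and
    increasing.\<close>
  also have "\<dots> \<le> (\<Sum>i\<in>I. x i * (4 * arsinh ((b - a) / \<delta>)))"
  proof (intro sum_mono mult_left_mono x)
    fix i assume "i \<in> I"
    then have "a \<le> p i" "p i \<le> b" using p by auto
    then have "\<beta> - p i \<le> b - a" "a - b \<le> \<alpha> - p i" using assms(5-7) by linarith+
    then have "(\<beta> - p i) / \<delta> \<le> (b - a) / \<delta>" "(a - b) / \<delta> \<le> (\<alpha> - p i) / \<delta>"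
      using assms(4) by (auto intro: divide_right_mono)
    moreover have "(a - b) / \<delta> = - ((b - a) / \<delta>)" by (simp add: minus_divide_left)
    ultimately have "(\<beta> - p i) / \<delta> \<le> (b - a) / \<delta>" "- ((b - a) / \<delta>) \<le> (\<alpha> - p i) / \<delta>"
      by simp_all
    then have "arsinh ((\<beta> - p i) / \<delta>) \<le> arsinh ((b - a) / \<delta>)"
      "arsinh (- ((b - a) / \<delta>)) \<le> arsinh ((\<alpha> - p i) / \<delta>)"
      using arsinh_real_strict_mono by (metis less_eq_real_def)+
    then show "2 * arsinh ((\<beta> - p i) / \<delta>) - 2 * arsinh ((\<alpha> - p i) / \<delta>) \<le> 4 * arsinh ((b - a) / \<delta>)"
      by (simp only: arsinh_minus_real)
  qed
  finally have "(\<beta> - \<alpha>) * \<phi> r \<le> 4 * arsinh ((b - a) / \<delta>) * sum x I"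
    using r by (simp add: sum_distrib_right[symmetric] mult.commute)
  then have "\<phi> r \<le> 4 * arsinh ((b - a) / \<delta>) / (\<beta> - \<alpha>) * sum x I"
    using assms by (simp add: field_simps)
  with r that show ?thesis by (simp add: \<phi>_def)
qed

text \<open>The root in the formula for \<open>arsinh (n / 2)\<close> is at most n/2 + 1, which
  leaves ln (n + 1) \<le> ln (2n); passing to base 2 only increases this.\<close>

lemma arsinh_half_le:
  assumes "1 \<le> n" "t \<le> n / 2"
  shows "arsinh t \<le> log 2 (2 * n)"
proof -
  have "arsinh t \<le> arsinh (n / 2)"
    using arsinh_real_strict_mono assms by (metis less_eq_real_def)
  also have "\<dots> = ln (n / 2 + sqrt ((n / 2)\<^sup>2 + 1))"
    by (rule arsinh_real_def)
  also have "\<dots> \<le> ln (2 * n)"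
  proof -
    have "sqrt ((n / 2)\<^sup>2 + 1) \<le> n / 2 + 1"
      using assms by (intro real_le_lsqrt) (auto simp: power2_eq_square algebra_simps)
    moreover have "0 < n / 2 + sqrt ((n / 2)\<^sup>2 + 1)" using assms by (simp add: add_pos_nonneg)
    ultimately show ?thesis using assms by (subst ln_le_cancel_iff) auto
  qed
  also have "\<dots> \<le> log 2 (2 * n)"
    using ln_2_less_1 assms by (simp add: log_def field_simps mult_left_le)
  finally show ?thesis .
qed

section \<open>One cut around a ball\<close>

context ball_growing
begin

text \<open>Bounding \<open>d\<close> by 1/19 in the ball and by 1 elsewhere gives |X|/10 \<le> |X|
  - (18/19)|Z|, that is |Z| \<le> (19/20)|X|. This fixes the largest radius 1/19.\<close>

lemma card_ball_le:
  assumes "X \<subseteq> V" and d1: "\<And>v. v \<in> X \<Longrightarrow> d v \<le> (1::real)"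
    and dsum: "real (card X) / 10 \<le> (\<Sum>v\<in>X. d v)"
    and dnd: "\<And>v. v \<in> X \<Longrightarrow> v \<in> H \<Longrightarrow> d v \<le> nd v" and r: "r \<le> 1 / 19"
  shows "real (card ({v \<in> H. nd v \<le> r} \<inter> X)) \<le> 95 / 100 * real (card X)"
proof -
  let ?Z = "{v \<in> H. nd v \<le> r} \<inter> X"
  have fin: "finite X" using assms(1) finite_V finite_subset by blast
  have "real (card X) / 10 \<le> (\<Sum>v\<in>X. d v)" by (rule dsum)
  also have "\<dots> = (\<Sum>v\<in>X - ?Z. d v) + (\<Sum>v\<in>?Z. d v)"
    using fin by (intro sum.subset_diff) auto
  also have "\<dots> \<le> real (card (X - ?Z)) * 1 + real (card ?Z) * (1 / 19)"
  proof (intro add_mono sum_bounded_above)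
    show "d v \<le> 1 / 19" if "v \<in> ?Z" for v using dnd[of v] that r by auto
  qed (use d1 in auto)
  also have "real (card (X - ?Z)) = real (card X) - real (card ?Z)"
    using fin card_mono[of X ?Z] by (subst card_Diff_subset) (auto simp: of_nat_diff)
  finally show ?thesis by simp
qed

lemma exists_cut:
  fixes f :: real and T :: nat
  defines "n \<equiv> real (card V)"
  assumes X: "X \<subseteq> V" and d1: "\<And>v. v \<in> X \<Longrightarrow> d v \<le> (1::real)"
    and dsum: "real (card X) / 10 \<le> (\<Sum>v\<in>X. d v)"
    and dnd: "\<And>v. v \<in> X \<Longrightarrow> v \<in> H \<Longrightarrow> d v \<le> nd v"
    and big: "95 / 100 * real (card X) < real (card (H \<inter> X))"
    and f: "0 < f" and T: "8 \<le> T" "152 * f \<le> 2 ^ T"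
    and z_lower: "\<And>A. A \<in> \<F> \<Longrightarrow> f / n \<le> z A" and z_total: "(\<Sum>A\<in>\<F>. z A) \<le> 2 * f"
    and wt_upper: "\<And>v. v \<in> V - S \<Longrightarrow> wt z v < 1 / (152 * real T)"
  obtains C Z y where "C \<subseteq> H" "Z \<subseteq> H" "u \<in> Z"
    "\<And>v w. (v, w) \<in> R \<Longrightarrow> v \<in> C \<Longrightarrow> w \<in> S \<union> C"
    "\<And>v w. v \<in> Z \<Longrightarrow> w \<in> H - C \<Longrightarrow> (v, w) \<in> E \<Longrightarrow> w \<in> Z"
    "real (card (Z \<inter> X)) \<le> 95 / 100 * real (card X)"
    "fractional_cover \<F> C y"
    "(\<Sum>A\<in>\<F>. y A) \<le> 304 * real T * log 2 (2 * n) * (\<Sum>A | A \<in> \<F> \<and> cen A \<in> Z. z A)"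
proof -
  \<comment> \<open>The \<open>T\<close> rings of width \<open>W\<close> fill the distances from
    1/38 to 1/19. Vertices outside \<open>S\<close> weigh less than \<open>\<theta>\<close>, a
    quarter of a ring, so margins of \<open>\<theta>\<close> on both sides leave half a ring for the
    radius.\<close>
  define W where "W = 1 / (38 * real T)"
  define \<theta> where "\<theta> = 1 / (152 * real T)"
  define \<delta> where "\<delta> = f / n"
  have W\<theta>: "W = 4 * \<theta>" "0 < \<theta>" "\<theta> \<le> 1 / 76" "real T * W = 1 / 38"
    using T by (auto simp: W_def \<theta>_def field_simps)
  have "u \<in> V" using u_H H_sub by auto
  then have n: "1 \<le> n" using finite_V by (simp add: n_def Suc_le_eq card_gt_0_iff) blast
  have \<delta>: "0 < \<delta>" using n f by (simp add: \<delta>_def)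
  have ball: "real (card ({v \<in> H. nd v \<le> r} \<inter> X)) \<le> 95 / 100 * real (card X)" if "r \<le> 1 / 19" for r
    using card_ball_le[OF X d1 dsum dnd that] by simp
  \<comment> \<open>Otherwise the ball of radius 1/38 would be all of \<open>H\<close>, which
    contains too much of \<open>X\<close>.\<close>
  obtain w where w: "w \<in> H" "1 / 38 < nd w"
  proof (rule ccontr)
    assume "\<not> thesis"
    with that have "{v \<in> H. nd v \<le> 1 / 38} = H" using not_less by blast
    with ball[of "1 / 38"] big show False by simp
  qed
  have wt\<theta>: "wt z v < \<theta>" if "v \<in> V - S" for v using wt_upper that by (simp add: \<theta>_def)
  have low: "1 / 76 < ballvol (1 / 38)"
    using ballvol_lower[OF wt\<theta> _ w] W\<theta> by fastforce
  \<comment> \<open>This lower bound on \<open>f\<close> later keeps \<open>W / \<delta>\<close>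
    below n/2.\<close>
  have "1 / 152 < f"
    using low ballvol_le_total[of "1 / 38"] z_total by linarith
  define a where "a j = 1 / 38 + real j * W" for j
  \<comment> \<open>More than doubling in all \<open>T\<close> rings would lift the volume from
    above 1/76 to above 2^T / 76, which is at least the total mass 2f.\<close>
  have "\<exists>j<T. ballvol (a (Suc j)) \<le> 2 * ballvol (a j)"
  proof (rule exists_non_doubling)
    show "1 / 76 < ballvol (a 0)" using low by (simp add: a_def)
    show "ballvol (a T) \<le> 2 ^ T * (1 / 76)" using ballvol_le_total[of "a T"] z_total T by simp
  qed
  then obtain j where j: "j < T" "ballvol (a (Suc j)) \<le> 2 * ballvol (a j)" by blast
  have aS: "a (Suc j) = a j + 4 * \<theta>" using W\<theta> by (simp add: a_def algebra_simps)
  have "real (Suc j) * W \<le> real T * W" using j W\<theta> by (intro mult_right_mono) auto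
  then have aT: "a (Suc j) \<le> 1 / 19" unfolding a_def using W\<theta>(4) by linarith
  have a38: "1 / 38 \<le> a j" using W\<theta> by (simp add: a_def)
  define ring where "ring = {A \<in> \<F>. cen A \<in> H \<and> a j < nd (cen A) \<and> nd (cen A) \<le> a (Suc j)}"
  have ring: "finite ring" "ring \<subseteq> \<F>" using finite_F by (auto simp: ring_def)
  obtain r where r: "a j + \<theta> < r" "r < a (Suc j) - \<theta>"
    "(\<Sum>A\<in>ring. z A * (2 / (\<delta> * sqrt (((r - nd (cen A)) / \<delta>)\<^sup>2 + 1))))
      \<le> 4 * arsinh ((a (Suc j) - a j) / \<delta>) / ((a (Suc j) - \<theta>) - (a j + \<theta>)) * sum z ring"
    by (rule exists_cheap_radius[OF ring(1), of z "\<lambda>A. nd (cen A)" "a j" "a (Suc j)" \<delta>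
          "a j + \<theta>" "a (Suc j) - \<theta>"])
      (use z_nonneg ring W\<theta> \<delta> aS in \<open>auto simp: ring_def\<close>)
  define C where "C = {v \<in> H. nd v - wt z v \<le> r \<and> r < nd v}"
  define Z where "Z = {v \<in> H. nd v \<le> r}"
  define y where "y A = (if A \<in> ring then z A * (2 / (\<delta> * sqrt (((r - nd (cen A)) / \<delta>)\<^sup>2 + 1))) else 0)" for A
  show thesis
  proof (rule that)
    show "C \<subseteq> H" "Z \<subseteq> H" by (auto simp: C_def Z_def)
    have "nd u < \<theta>" using nd_root_le wt\<theta>[of u] u_H H_sub by fastforce
    then show "u \<in> Z" using r a38 W\<theta> u_H by (simp add: Z_def)
    show "w \<in> S \<union> C" if "(v, w) \<in> R" "v \<in> C" for v w
    proof (cases "w \<in> S")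
      case False
      then have "w \<in> H" using H_comp[of v w] that R_sub E_sub by (auto simp: C_def)
      then show ?thesis using nd_arc[of w v] that by (auto simp: C_def)
    qed simp
    \<comment> \<open>Entering \<open>w\<close> costs at most its weight, so
      \<open>nd w - wt z w\<close> is at most \<open>r\<close>; outside \<open>C\<close> this forces
      \<open>nd w \<le> r\<close>.\<close>
    show "w \<in> Z" if "v \<in> Z" "w \<in> H - C" "(v, w) \<in> E" for v w
      using that nd_edge_le[of v w] by (auto simp: Z_def C_def)
    show "real (card (Z \<inter> X)) \<le> 95 / 100 * real (card X)"
      unfolding Z_def using r aT W\<theta> by (intro ball) simp
    show "fractional_cover \<F> C y"
      unfolding fractional_cover_def
    proof (intro conjI ballI)
      show "0 \<le> y A" if "A \<in> \<F>" for A using z_nonneg that \<delta> by (simp add: y_def)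
      fix v assume v: "v \<in> C"
      then have vH: "v \<in> H" "v \<in> V - S" using H_sub by (auto simp: C_def)
      obtain A0 where A0: "A0 \<in> \<F>" "v \<in> A0" using covers vH by blast
      \<comment> \<open>The extra mass f / n makes every weight at least \<open>\<delta>\<close>,
        the scale at which \<open>y\<close> is smoothed.\<close>
      have "\<delta> \<le> z A0" using z_lower A0 by (simp add: \<delta>_def)
      also have "z A0 \<le> wt z v"
        unfolding wt_def using A0 finite_F z_nonneg by (intro member_le_sum) auto
      finally have \<delta>wt: "\<delta> \<le> wt z v" .
      \<comment> \<open>The shares \<open>z A / wt z v\<close> of the members containing
        \<open>v\<close> sum to 1, so it is enough that \<open>y\<close> dominates each share. The
        margins put the centers of these members into the ring.\<close>
      have "z A * (1 / wt z v) \<le> y A" if A: "A \<in> \<F>" "v \<in> A" for A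
      proof -
        have nc: "cen A \<in> H" "nd (cen A) \<le> nd v" "nd v \<le> nd (cen A) + wt z v"
          using nd_cen[OF A vH(1)] by auto
        then have dist: "\<bar>r - nd (cen A)\<bar> \<le> wt z v" using v by (auto simp: C_def)
        then have "A \<in> ring" using A nc r wt\<theta>[OF vH(2)] by (auto simp: ring_def)
        have "\<delta> * sqrt (((r - nd (cen A)) / \<delta>)\<^sup>2 + 1) \<le> \<delta> * (\<bar>(r - nd (cen A)) / \<delta>\<bar> + 1)"
          using \<delta> by (intro mult_left_mono real_le_lsqrt) (auto simp: power2_eq_square algebra_simps)
        also have "\<dots> = \<bar>r - nd (cen A)\<bar> + \<delta>" using \<delta> by (simp add: field_simps)
        also have "\<dots> \<le> 2 * wt z v" using dist \<delta>wt by simp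
        finally have le: "\<delta> * sqrt (((r - nd (cen A)) / \<delta>)\<^sup>2 + 1) \<le> 2 * wt z v" .
        have "0 < \<delta> * sqrt (((r - nd (cen A)) / \<delta>)\<^sup>2 + 1)"
          using \<delta> by (intro mult_pos_pos real_sqrt_gt_zero add_nonneg_pos) auto
        from divide_left_mono[OF le _ mult_pos_pos[OF _ this], of 2] \<delta> \<delta>wt
        have "1 / wt z v \<le> 2 / (\<delta> * sqrt (((r - nd (cen A)) / \<delta>)\<^sup>2 + 1))" by simp
        from mult_left_mono[OF this z_nonneg[OF A(1)]] show ?thesis
          using \<open>A \<in> ring\<close> by (simp add: y_def)
      qed
      then have "(\<Sum>A | A \<in> \<F> \<and> v \<in> A. z A * (1 / wt z v)) \<le> (\<Sum>A | A \<in> \<F> \<and> v \<in> A. y A)"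
        by (intro sum_mono) auto
      moreover have "(\<Sum>A | A \<in> \<F> \<and> v \<in> A. z A * (1 / wt z v)) = 1"
        using \<delta> \<delta>wt by (simp only: sum_distrib_right[symmetric] wt_def[symmetric]) simp
      ultimately show "1 \<le> (\<Sum>A | A \<in> \<F> \<and> v \<in> A. y A)" by simp
    qed
    have L: "0 \<le> log 2 (2 * n)" using n by simp
    have "sum z ring = ballvol (a (Suc j)) - ballvol (a j)"
    proof -
      have "ring = {A \<in> \<F>. cen A \<in> H \<and> nd (cen A) \<le> a (Suc j)} - {A \<in> \<F>. cen A \<in> H \<and> nd (cen A) \<le> a j}"
        by (auto simp: ring_def)
      then show ?thesis
        unfolding ballvol_def using finite_F aS W\<theta> by (simp only:) (intro sum_diff; auto)
    qed
    also have "\<dots> \<le> ballvol (a j)" using j by simp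
    also have "\<dots> \<le> (\<Sum>A | A \<in> \<F> \<and> cen A \<in> Z. z A)"
      unfolding ballvol_def Z_def using z_nonneg finite_F r W\<theta> by (intro sum_mono2) auto
    finally have ringZ: "sum z ring \<le> (\<Sum>A | A \<in> \<F> \<and> cen A \<in> Z. z A)" .
    have "(\<Sum>A\<in>\<F>. y A) = (\<Sum>A\<in>ring. y A)"
      using ring finite_F by (intro sum.mono_neutral_right) (auto simp: y_def)
    also have "\<dots> \<le> 4 * arsinh ((a (Suc j) - a j) / \<delta>) / ((a (Suc j) - \<theta>) - (a j + \<theta>)) * sum z ring"
      using r(3) by (simp add: y_def)
    \<comment> \<open>The radius is chosen in an interval of length 2\<open>\<theta>\<close> = 1/(76
      T), and 4 divided by this is 304 T.\<close>
    also have "\<dots> = 304 * real T * arsinh (W / \<delta>) * sum z ring"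
      using W\<theta>(1) T aS by (simp add: \<theta>_def)
    also have "\<dots> \<le> 304 * real T * log 2 (2 * n) * sum z ring"
    proof -
      \<comment> \<open>Since T \<ge> 8 and f > 1/152, the product 38 T f is at least 2.\<close>
      have "W / \<delta> = n * (1 / (38 * real T * f))" by (simp add: W_def \<delta>_def)
      also have "\<dots> \<le> n * (1 / 2)"
      proof (intro mult_left_mono)
        have "8 * (1 / 152) \<le> real T * f" using T \<open>1 / 152 < f\<close> by (intro mult_mono) auto
        then show "1 / (38 * real T * f) \<le> 1 / 2" using T f by (simp add: field_simps)
      qed (use n in simp)
      finally have "arsinh (W / \<delta>) \<le> log 2 (2 * n)" using n by (intro arsinh_half_le) auto
      moreover have "0 \<le> sum z ring" using z_nonneg ring by (intro sum_nonneg) auto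
      ultimately show ?thesis by (intro mult_right_mono mult_left_mono) auto
    qed
    also have "\<dots> \<le> 304 * real T * log 2 (2 * n) * (\<Sum>A | A \<in> \<F> \<and> cen A \<in> Z. z A)"
      using ringZ L by (intro mult_left_mono) auto
    finally show "(\<Sum>A\<in>\<F>. y A) \<le> 304 * real T * log 2 (2 * n) * (\<Sum>A | A \<in> \<F> \<and> cen A \<in> Z. z A)" .
  qed
qed

end

section \<open>Iterated cutting\<close>

lemma fractional_cover_add:
  assumes "fractional_cover \<F> S y" "fractional_cover \<F> S' y'"
  shows "fractional_cover \<F> (S \<union> S') (\<lambda>A. y A + y' A)"
proof -
  have "0 \<le> (\<Sum>A | A \<in> \<F> \<and> v \<in> A. y A)" "0 \<le> (\<Sum>A | A \<in> \<F> \<and> v \<in> A. y' A)" for v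
    using assms by (auto simp: fractional_cover_def intro!: sum_nonneg)
  then show ?thesis
    using assms by (fastforce simp: fractional_cover_def sum.distrib intro: add_increasing add_increasing2)
qed

context cone_family
begin

definition closed_set :: "'a set \<Rightarrow> bool" where
  "closed_set S \<longleftrightarrow> S \<subseteq> V \<and> R `` S \<subseteq> S"

text \<open>Any connected set qualifies, not only a component, so the notion does not depend on the
  set being deleted.\<close>

definition big :: "'a set \<Rightarrow> 'a set \<Rightarrow> bool" where
  "big X B \<longleftrightarrow> connected_set E B \<and> 95 / 100 * real (card X) < real (card (B \<inter> X))"

text \<open>Each set holds more than half of \<open>X\<close>.\<close>

lemma big_inter:
  assumes "X \<subseteq> V" "big X B" "big X C"
  shows "B \<inter> C \<noteq> {}"
proof
  assume disj: "B \<inter> C = {}"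
  have "finite X" using assms(1) finite_V finite_subset by blast
  then have "card (B \<inter> X) + card (C \<inter> X) \<le> card X"
    using disj by (subst card_Un_disjoint[symmetric]) (auto intro!: card_mono)
  then show False using assms by (simp add: big_def)
qed

text \<open>
  The set \<open>M\<close> contains whatever big component is left. It loses the ball in every round, so the
  charges of different rounds go to members with distinct centers.
\<close>

lemma extend_to_separator:
  fixes f :: real and T :: nat
  defines "n \<equiv> real (card V)"
  assumes X: "X \<subseteq> V" and d1: "\<And>u v. u \<in> X \<Longrightarrow> v \<in> X \<Longrightarrow> d u v \<le> (1::real)"
    and dsum: "\<And>u. u \<in> X \<Longrightarrow> real (card X) / 10 \<le> (\<Sum>v\<in>X. d u v)"
    and dmass: "\<And>B u v. connected_set E B \<Longrightarrow> B \<subseteq> V \<Longrightarrow> u \<in> B \<inter> X \<Longrightarrow> v \<in> B \<inter> X \<Longrightarrow> d u v \<le> mass z B"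
    and f: "0 < f" and T: "8 \<le> T" "152 * f \<le> 2 ^ T"
    and z_nonneg: "\<And>A. A \<in> \<F> \<Longrightarrow> 0 \<le> z A"
    and z_lower: "\<And>A. A \<in> \<F> \<Longrightarrow> f / n \<le> z A" and z_total: "(\<Sum>A\<in>\<F>. z A) \<le> 2 * f"
    and S: "closed_set S" "\<And>v. v \<in> V - S \<Longrightarrow> wt z v < 1 / (152 * real T)"
    and M: "M \<subseteq> V" "\<And>B. big X B \<Longrightarrow> B \<subseteq> V - S \<Longrightarrow> B \<subseteq> M"
  shows "\<exists>S' y. S \<subseteq> S' \<and> closed_set S' \<and> (\<forall>B. B \<subseteq> V - S' \<longrightarrow> \<not> big X B) \<and> fractional_cover \<F> (S' - S) y \<and>
      (\<Sum>A\<in>\<F>. y A) \<le> 304 * real T * log 2 (2 * n) * (\<Sum>A | A \<in> \<F> \<and> cen A \<in> M. z A)"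
  using S M
proof (induction "card M" arbitrary: S M rule: less_induct)
  case less
  let ?K = "304 * real T * log 2 (2 * n)"
  \<comment> \<open>For empty \<open>V\<close> the logarithm is \<open>log 2 0\<close>, which is 0
    by convention.\<close>
  have K: "0 \<le> ?K"
  proof (cases "V = {}")
    case False
    then have "1 \<le> n" using finite_V by (simp add: n_def Suc_le_eq card_gt_0_iff)
    then show ?thesis by simp
  qed (simp add: n_def log_def)
  show ?case
  proof (cases "\<exists>B. B \<subseteq> V - S \<and> big X B")
    case False
    have "0 \<le> ?K * (\<Sum>A | A \<in> \<F> \<and> cen A \<in> M. z A)"
      using z_nonneg by (intro mult_nonneg_nonneg[OF K] sum_nonneg) auto
    then show ?thesis
      using False less.prems by (intro exI[of _ S] exI[of _ "\<lambda>_. 0"]) (auto simp: fractional_cover_def)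
  next
    case True
    then obtain B where B: "B \<subseteq> V - S" "big X B" by blast
    then have "B \<inter> X \<noteq> {}" by (auto simp: big_def)
    then obtain u where u: "u \<in> B" "u \<in> X" by blast
    \<comment> \<open>Passing from \<open>B\<close> to its component in \<open>V - S\<close>
      provides the closure under edges that ball growing requires.\<close>
    obtain H where H: "connected_set E H" "B \<subseteq> H" "H \<subseteq> V - S"
        and H_comp: "\<And>v w. v \<in> H \<Longrightarrow> (v, w) \<in> E \<Longrightarrow> w \<in> V - S \<Longrightarrow> w \<in> H"
      using connected_set_exists_component[OF sym_E, of B "V - S" u] B u by (auto simp: big_def)
    have "finite (H \<inter> X)" using X finite_V by (meson finite_Int finite_subset)
    then have "card (B \<inter> X) \<le> card (H \<inter> X)" using H by (intro card_mono) auto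
    then have bigH: "big X H" using B H by (auto simp: big_def)
    then have HM: "H \<subseteq> M" using less.prems H by blast
    interpret ball_growing V E R \<F> cen z S H u
      using z_nonneg less.prems H H_comp u by unfold_locales (auto simp: closed_set_def)
    have dnd: "d u v \<le> nd v" if v: "v \<in> X" "v \<in> H" for v
    proof -
      obtain C where C: "C \<in> joining v" "nd v = mass z C" using nd_attained v by blast
      then show ?thesis using dmass[of C u v] v u H by (auto simp: joining_def)
    qed
    obtain C Z y where CZ: "C \<subseteq> H" "Z \<subseteq> H" "u \<in> Z"
      and C_cl: "\<And>v w. (v, w) \<in> R \<Longrightarrow> v \<in> C \<Longrightarrow> w \<in> S \<union> C"
      and sep: "\<And>v w. v \<in> Z \<Longrightarrow> w \<in> H - C \<Longrightarrow> (v, w) \<in> E \<Longrightarrow> w \<in> Z"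
      and Zs: "real (card (Z \<inter> X)) \<le> 95 / 100 * real (card X)"
      and y: "fractional_cover \<F> C y" "(\<Sum>A\<in>\<F>. y A) \<le> ?K * (\<Sum>A | A \<in> \<F> \<and> cen A \<in> Z. z A)"
      using exists_cut[OF X, of "d u" f T] d1 dsum dnd u bigH f T z_lower z_total less.prems
      unfolding big_def n_def by blast
    let ?S = "S \<union> C" and ?M = "H - Z"
    have "finite M" using less.prems finite_V finite_subset by blast
    then have card: "card ?M < card M" using HM CZ by (intro psubset_card_mono) auto
    \<comment> \<open>A remaining big set meets \<open>H\<close> by \<open>big_inter\<close>, hence
      lies in the component \<open>H\<close>. If it met \<open>Z\<close>, it would be trapped in
      \<open>Z\<close> by \<open>sep\<close>, but \<open>Z\<close> holds too little of
      \<open>X\<close>.\<close>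
    have bigM: "D \<subseteq> ?M" if D: "big X D" "D \<subseteq> V - ?S" for D
    proof -
      obtain h where h: "h \<in> D" "h \<in> H" using big_inter[OF X D(1) bigH] by blast
      have DH: "D \<subseteq> H"
        by (rule connected_set_subset_closed[of E D h]) (use D h H_comp in \<open>auto simp: big_def\<close>)
      have "D \<inter> Z = {}"
      proof (rule ccontr)
        assume "D \<inter> Z \<noteq> {}"
        then obtain c where c: "c \<in> D" "c \<in> Z" by blast
        have "D \<subseteq> Z"
          by (rule connected_set_subset_closed[of E D c]) (use D c DH sep in \<open>auto simp: big_def\<close>)
        moreover have "finite (Z \<inter> X)" using X finite_V by (meson finite_Int finite_subset)
        ultimately have "card (D \<inter> X) \<le> card (Z \<inter> X)" by (intro card_mono) auto
        then show False using Zs D by (auto simp: big_def)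
      qed
      with DH show ?thesis by blast
    qed
    have cl: "closed_set ?S" using less.prems(1) C_cl CZ(1) H(3) unfolding closed_set_def by blast
    have wtS: "wt z v < 1 / (152 * real T)" if "v \<in> V - ?S" for v using less.prems(2) that by blast
    have MV: "?M \<subseteq> V" using H(3) by blast
    have "\<exists>S' y'. ?S \<subseteq> S' \<and> closed_set S' \<and> (\<forall>B. B \<subseteq> V - S' \<longrightarrow> \<not> big X B) \<and>
        fractional_cover \<F> (S' - ?S) y' \<and>
        (\<Sum>A\<in>\<F>. y' A) \<le> ?K * (\<Sum>A | A \<in> \<F> \<and> cen A \<in> ?M. z A)"
      by (rule less.hyps[OF card cl wtS MV bigM])
    then obtain S' y' where S': "?S \<subseteq> S'" "closed_set S'" "\<forall>B. B \<subseteq> V - S' \<longrightarrow> \<not> big X B"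
      and y': "fractional_cover \<F> (S' - ?S) y'"
        "(\<Sum>A\<in>\<F>. y' A) \<le> ?K * (\<Sum>A | A \<in> \<F> \<and> cen A \<in> ?M. z A)"
      by (elim exE conjE) (rule that)
    have "fractional_cover \<F> (C \<union> (S' - ?S)) (\<lambda>A. y A + y' A)"
      using fractional_cover_add y y' by blast
    then have cov: "fractional_cover \<F> (S' - S) (\<lambda>A. y A + y' A)"
      by (auto simp: fractional_cover_def)
    \<comment> \<open>\<open>Z\<close> and \<open>H - Z\<close> are disjoint parts of
      \<open>M\<close>, so this round and the later ones charge different members.\<close>
    have "(\<Sum>A | A \<in> \<F> \<and> cen A \<in> Z. z A) + (\<Sum>A | A \<in> \<F> \<and> cen A \<in> ?M. z A)
        = (\<Sum>A\<in>{A \<in> \<F>. cen A \<in> Z} \<union> {A \<in> \<F>. cen A \<in> ?M}. z A)"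
      using finite_F by (intro sum.union_disjoint[symmetric]) auto
    also have "\<dots> \<le> (\<Sum>A | A \<in> \<F> \<and> cen A \<in> M. z A)"
      using finite_F z_nonneg HM CZ by (intro sum_mono2) auto
    finally have "(\<Sum>A\<in>\<F>. y A + y' A) \<le> ?K * (\<Sum>A | A \<in> \<F> \<and> cen A \<in> M. z A)"
      using y(2) y'(2) mult_left_mono[OF _ K] unfolding sum.distrib
      by (smt (verit) distrib_left)
    then show ?thesis using S' cov by (intro exI[of _ S'] exI[of _ "\<lambda>A. y A + y' A"]) auto
  qed
qed

lemma exists_closed_separator:
  fixes x :: "'a set \<Rightarrow> real"
  defines "n \<equiv> real (card V)" and "f \<equiv> \<Sum>A\<in>\<F>. x A"
  assumes X: "X \<subseteq> V" and d1: "\<And>u v. u \<in> X \<Longrightarrow> v \<in> X \<Longrightarrow> d u v \<le> (1::real)"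
    and dsum: "\<And>u. u \<in> X \<Longrightarrow> real (card X) / 10 \<le> (\<Sum>v\<in>X. d u v)"
    and dmass: "\<And>B u v. connected_set E B \<Longrightarrow> B \<subseteq> V \<Longrightarrow> u \<in> B \<inter> X \<Longrightarrow> v \<in> B \<inter> X \<Longrightarrow> d u v \<le> mass x B"
    and x: "\<And>A. A \<in> \<F> \<Longrightarrow> 0 \<le> x A"
  obtains S y where "closed_set S" "\<forall>B. B \<subseteq> V - S \<longrightarrow> \<not> big X B" "fractional_cover \<F> S y"
    "(\<Sum>A\<in>\<F>. y A) \<le> 3648 * log 2 (2 * n) * log 2 (f + 4) * f"
proof (cases "f = 0")
  case True
  have finX: "finite X" using X finite_V finite_subset by blast
  \<comment> \<open>With no mass at all, \<open>d\<close> is at most 0 within every connected set. A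
    big one leaves less than 5% of \<open>X\<close> outside, too little for row sums of |X|/10, so
    the empty separator works.\<close>
  have "\<not> big X B" if B: "B \<subseteq> V" for B
  proof
    assume big: "big X B"
    then have "B \<inter> X \<noteq> {}" by (auto simp: big_def)
    then obtain u where u: "u \<in> B" "u \<in> X" by blast
    have "mass x B \<le> 0" using mass_le_total[of x B, OF x] True by (simp add: f_def)
    then have d0: "d u v \<le> 0" if "v \<in> B \<inter> X" for v
      using dmass[of B u v] big u that B by (auto simp: big_def)
    have "real (card X) / 10 \<le> (\<Sum>v\<in>X. d u v)" using dsum u by blast
    also have "\<dots> = (\<Sum>v\<in>X - B \<inter> X. d u v) + (\<Sum>v\<in>B \<inter> X. d u v)"
      using finX by (intro sum.subset_diff) auto
    also have "\<dots> \<le> real (card (X - B \<inter> X)) * 1 + real (card (B \<inter> X)) * 0"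
      using d1 d0 u by (intro add_mono sum_bounded_above) auto
    also have "real (card (X - B \<inter> X)) = real (card X) - real (card (B \<inter> X))"
      using finX card_mono[of X "B \<inter> X"] by (subst card_Diff_subset) (auto simp: of_nat_diff)
    finally show False using big by (simp add: big_def)
  qed
  then show thesis
    using that[of "{}" "\<lambda>_. 0"] True by (auto simp: closed_set_def fractional_cover_def)
next
  case False
  then have f: "0 < f" using x sum_nonneg[of \<F> x] by (force simp: f_def)
  have "\<F> \<noteq> {}" using False by (auto simp: f_def)
  then have "V \<noteq> {}" using cen_V by blast
  then have n: "1 \<le> n" using finite_V by (simp add: n_def Suc_le_eq card_gt_0_iff)
  define z where "z A = x A + f / n" for A
  have zx: "x A \<le> z A" for A using f n by (simp add: z_def)
  have z0: "0 \<le> z A" if "A \<in> \<F>" for A using zx[of A] x[OF that] by simp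
  have "(\<Sum>A\<in>\<F>. z A) = f + real (card \<F>) * (f / n)" by (simp add: z_def sum.distrib f_def)
  also have "\<dots> \<le> f + n * (f / n)"
    using card_F f n by (intro add_left_mono mult_right_mono) (auto simp: n_def)
  finally have z_total: "(\<Sum>A\<in>\<F>. z A) \<le> 2 * f" using n by simp
  \<comment> \<open>Rounding down keeps \<open>T\<close> linear in the logarithm for the final
    bound, while 2^(T + 1) still exceeds (f + 4)^4.\<close>
  define T where "T = nat \<lfloor>4 * log 2 (f + 4)\<rfloor>"
  have log4: "2 \<le> log 2 (f + 4)" using f by (simp add: le_log_iff)
  have T_ge: "8 \<le> T" unfolding T_def using log4 by (simp add: le_nat_iff le_floor_iff)
  have T_le: "real T \<le> 4 * log 2 (f + 4)" unfolding T_def using log4 by simp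
  have T_gt: "4 * log 2 (f + 4) < real T + 1" unfolding T_def using log4 by linarith
  have "152 * f \<le> 2 ^ T"
  proof -
    have "(f + 4) ^ 4 = 256 + 256 * f + 96 * f\<^sup>2 + 16 * f ^ 3 + f ^ 4"
      by (simp add: power_numeral_reduce algebra_simps)
    \<comment> \<open>This is (f - 1/4)^2 \<ge> 0 scaled by 96; it supplies the 48 f missing between
      256 f and 304 f.\<close>
    moreover have "48 * f \<le> 96 * f\<^sup>2 + 6"
      using zero_le_power2[of "f - 1 / 4"] by (simp add: power2_eq_square algebra_simps)
    moreover have "0 \<le> f ^ 3" "0 \<le> f ^ 4" using f by simp_all
    ultimately have "304 * f \<le> (f + 4) ^ 4" by linarith
    also have "(f + 4) ^ 4 = 2 powr (log 2 ((f + 4) ^ 4))" using f by simp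
    also have "\<dots> = 2 powr (4 * log 2 (f + 4))" using f by (simp add: log_nat_power)
    also have "\<dots> \<le> 2 powr (real (T + 1))" using T_gt by (intro powr_mono) auto
    also have "\<dots> = 2 ^ (T + 1)" by (subst powr_realpow) auto
    finally show ?thesis by simp
  qed
  \<comment> \<open>The heavy vertices form a closed set because weights do not decrease along arcs,
    and \<open>z\<close> scaled by \<open>152 * real T\<close> covers them.\<close>
  define S0 where "S0 = {v \<in> V. 1 / (152 * real T) \<le> wt z v}"
  have S0: "closed_set S0"
    using wt_mono[of z, OF z0] R_sub E_sub by (fastforce simp: closed_set_def S0_def)
  have dmz: "d u v \<le> mass z B" if "connected_set E B" "B \<subseteq> V" "u \<in> B \<inter> X" "v \<in> B \<inter> X" for B u v
    using dmass[OF that] mass_mono_weight[of x z B] zx by fastforce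
  have "\<exists>S' y. S0 \<subseteq> S' \<and> closed_set S' \<and> (\<forall>B. B \<subseteq> V - S' \<longrightarrow> \<not> big X B) \<and> fractional_cover \<F> (S' - S0) y \<and>
      (\<Sum>A\<in>\<F>. y A) \<le> 304 * real T * log 2 (2 * real (card V)) * (\<Sum>A | A \<in> \<F> \<and> cen A \<in> V. z A)"
  proof (rule extend_to_separator[OF X d1 dsum dmz f T_ge \<open>152 * f \<le> 2 ^ T\<close> z0 _ z_total S0])
    show "f / real (card V) \<le> z A" if "A \<in> \<F>" for A using x that by (simp add: z_def n_def)
  qed (auto simp: S0_def)
  then obtain S y where S: "S0 \<subseteq> S" "closed_set S" "\<forall>B. B \<subseteq> V - S \<longrightarrow> \<not> big X B"
    and y: "fractional_cover \<F> (S - S0) y"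
      "(\<Sum>A\<in>\<F>. y A) \<le> 304 * real T * log 2 (2 * n) * (\<Sum>A | A \<in> \<F> \<and> cen A \<in> V. z A)"
    unfolding n_def by blast
  have y0: "fractional_cover \<F> S0 (\<lambda>A. 152 * real T * z A)"
    unfolding fractional_cover_def
  proof (intro conjI ballI)
    fix v assume "v \<in> S0"
    then have "1 \<le> 152 * real T * wt z v" using T_ge by (simp add: S0_def field_simps)
    then show "1 \<le> (\<Sum>A | A \<in> \<F> \<and> v \<in> A. 152 * real T * z A)"
      by (simp only: wt_def sum_distrib_left)
  qed (use z0 in auto)
  define y' where "y' A = 152 * real T * z A + y A" for A
  have "S0 \<union> (S - S0) = S" using S by blast
  then have cov: "fractional_cover \<F> S y'"
    using fractional_cover_add[OF y0 y(1)] by (simp add: y'_def[abs_def])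
  have L: "1 \<le> log 2 (2 * n)" using n by (simp add: log_mult)
  have "(\<Sum>A\<in>\<F>. y' A) = 152 * real T * (\<Sum>A\<in>\<F>. z A) + (\<Sum>A\<in>\<F>. y A)"
    by (simp add: y'_def sum.distrib sum_distrib_left)
  also have "\<dots> \<le> 152 * real T * (2 * f) + 304 * real T * log 2 (2 * n) * (2 * f)"
  proof (intro add_mono mult_left_mono z_total)
    have "{A \<in> \<F>. cen A \<in> V} = \<F>" using cen_V by auto
    then have "(\<Sum>A\<in>\<F>. y A) \<le> 304 * real T * log 2 (2 * n) * (\<Sum>A\<in>\<F>. z A)" using y(2) by simp
    also have "\<dots> \<le> 304 * real T * log 2 (2 * n) * (2 * f)"
      using z_total L by (intro mult_left_mono) auto
    finally show "(\<Sum>A\<in>\<F>. y A) \<le> 304 * real T * log 2 (2 * n) * (2 * f)" .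
  qed simp
  also have "\<dots> = 304 * (1 + 2 * log 2 (2 * n)) * f * real T" by (simp add: algebra_simps)
  \<comment> \<open>The summand 1 is absorbed using \<open>L\<close>; the constant 3648 is 304 * 3 *
    4.\<close>
  also have "\<dots> \<le> 304 * (3 * log 2 (2 * n)) * f * (4 * log 2 (f + 4))"
    using L T_le f by (intro mult_mono) auto
  finally show thesis using that[OF S(2,3) cov] by (simp add: mult_ac)
qed

end

section \<open>Layered families\<close>

lemma set_vwalk_arcs_subset_iff:
  "set (vwalk_arcs P) \<subseteq> E \<longleftrightarrow> successively (\<lambda>a b. (a, b) \<in> E) P"
  by (induction P rule: vwalk_arcs.induct) auto

text \<open>A shortest walk inside \<open>B\<close> is induced, since a chord or a repeated vertex
  would allow a shortcut.\<close>

lemma exists_induced_path: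
  fixes G :: "'a pair_pre_digraph"
  assumes B: "connected_set (parcs G) B" "B \<subseteq> pverts G" and uv: "u \<in> B" "v \<in> B"
  obtains P where "induced_path G u v P" "set P \<subseteq> B"
proof -
  define E where "E = parcs G"
  define walk where "walk P \<longleftrightarrow> P \<noteq> [] \<and> hd P = u \<and> last P = v \<and> set P \<subseteq> B \<and> successively (\<lambda>a b. (a, b) \<in> E) P"
    for P
  have "(u, v) \<in> (E \<inter> B \<times> B)\<^sup>*" using B uv by (simp add: connected_set_def E_def)
  then have "\<exists>P. P \<noteq> [] \<and> hd P = u \<and> last P = v \<and> set P \<subseteq> B \<and> successively (\<lambda>a b. (a, b) \<in> E) P"
  proof induction
    case base
    show ?case by (rule exI[of _ "[u]"]) (use uv in auto)
  next
    case (step y z)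
    then obtain P where P: "P \<noteq> []" "hd P = u" "last P = y" "set P \<subseteq> B" "successively (\<lambda>a b. (a, b) \<in> E) P"
      by blast
    then show ?case
      by (intro exI[of _ "P @ [z]"]) (use step in \<open>auto simp: successively_append_iff\<close>)
  qed
  then obtain P0 where "walk P0" unfolding walk_def by blast
  then obtain P where P: "walk P" "\<And>P'. walk P' \<Longrightarrow> length P \<le> length P'"
    using ex_has_least_nat[of walk P0 length] by blast
  \<comment> \<open>Positions strictly between \<open>i\<close> and \<open>l\<close> are cut out.
    The case \<open>l = length P\<close> drops the whole tail, which is possible when the walk has
    already reached its end at position \<open>i\<close>.\<close>
  have shortcut: "l = length P \<longrightarrow> P ! i \<noteq> last P" "l < length P \<longrightarrow> (P ! i, P ! l) \<notin> E"
    if il: "Suc i < l" "l \<le> length P" for i l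
  proof -
    let ?P = "take (Suc i) P @ drop l P"
    have len: "length ?P < length P" using il by simp
    have lst: "last (take (Suc i) P) = P ! i" using il by (simp add: take_Suc_conv_app_nth)
    have suc: "successively (\<lambda>a b. (a, b) \<in> E) (take m P)" "successively (\<lambda>a b. (a, b) \<in> E) (drop m P)" for m
      using P(1) successively_append_iff[of _ "take m P" "drop m P"] by (auto simp: walk_def)
    have base: "?P \<noteq> []" "hd ?P = u" "set ?P \<subseteq> B"
      using P(1) set_take_subset[of "Suc i" P] set_drop_subset[of l P] by (auto simp: walk_def)
    show "l = length P \<longrightarrow> P ! i \<noteq> last P"
    proof (intro impI notI)
      assume *: "l = length P" "P ! i = last P"
      have "walk ?P" unfolding walk_def using base suc lst * P(1) by (simp add: walk_def)
      with P(2) len show False by fastforce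
    qed
    show "l < length P \<longrightarrow> (P ! i, P ! l) \<notin> E"
    proof (intro impI notI)
      assume *: "l < length P" "(P ! i, P ! l) \<in> E"
      have "walk ?P" unfolding walk_def using base suc lst * P(1)
        by (simp add: walk_def successively_append_iff hd_drop_conv_nth)
      with P(2) len show False by fastforce
    qed
  qed
  \<comment> \<open>If \<open>P ! i = P ! j\<close> with i < j, the step from \<open>j\<close> to
    \<open>Suc j\<close> is also an edge from \<open>P ! i\<close>, hence a shortcut; for the last
    \<open>j\<close> the tail is dropped instead.\<close>
  have "distinct P"
    unfolding distinct_conv_nth
  proof (rule ccontr)
    assume "\<not> (\<forall>i<length P. \<forall>j<length P. i \<noteq> j \<longrightarrow> P ! i \<noteq> P ! j)"
    then obtain i j where ij: "i < j" "j < length P" "P ! i = P ! j"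
      by (metis linorder_neqE_nat)
    show False
    proof (cases "Suc j = length P")
      case True
      then have "P ! j = last P" by (metis P(1) diff_Suc_1 last_conv_nth walk_def)
      with shortcut(1)[of i "Suc j"] ij True show False by simp
    next
      case False
      then have "(P ! j, P ! Suc j) \<in> E"
        using P(1) ij by (auto simp: walk_def successively_conv_nth)
      with shortcut(2)[of i "Suc j"] ij False show False by simp
    qed
  qed
  moreover have "j = Suc i" if "i < j" "j < length P" "(P ! i, P ! j) \<in> E" for i j
    using shortcut(2)[of i j] that by (metis Suc_lessI less_imp_le)
  ultimately have "induced_path G u v P"
    using P(1) B(2) by (auto simp: induced_path_def vpath_def vwalk_def walk_def E_def set_vwalk_arcs_subset_iff)
  with P(1) that show thesis by (auto simp: walk_def)
qed

text \<open>Connectedness of \<open>C\<close> is reachability in its symmetric closure; as the arcs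
  of \<open>G\<close> are symmetric, this closure adds no arc outside \<open>G\<close>.\<close>

lemma connected_set_component:
  fixes G :: "'a pair_pre_digraph"
  assumes "pair_graph G" and C: "is_component (with_proj G \<restriction> U) C"
  shows "connected_set (parcs G) (verts C)" "verts C \<subseteq> U"
proof -
  interpret pair_graph G by fact
  have sub: "subgraph C (with_proj G \<restriction> U)" and conn: "connected C"
    using C by (auto simp: is_component_def pre_digraph.max_subgraph_def)
  from sub show "verts C \<subseteq> U" by (auto simp: subgraph_def)
  have "wf_digraph C" using sub by (simp add: subgraph_def)
  have arcs: "parcs (mk_symmetric C) \<subseteq> parcs G \<inter> verts C \<times> verts C"
  proof -
    have C: "tail C = fst" "head C = snd" "arcs C \<subseteq> parcs G"
      using sub by (auto simp: subgraph_def compatible_def)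
    have "fst e \<in> verts C" "snd e \<in> verts C" "(fst e, snd e) \<in> parcs G" "(snd e, fst e) \<in> parcs G"
      if e: "e \<in> arcs C" for e
    proof -
      show "fst e \<in> verts C" "snd e \<in> verts C"
        using wf_digraph.tail_in_verts[OF \<open>wf_digraph C\<close> e] wf_digraph.head_in_verts[OF \<open>wf_digraph C\<close> e] C
        by auto
      show *: "(fst e, snd e) \<in> parcs G" using e C by auto
      show "(snd e, fst e) \<in> parcs G" using graph_symmetric[OF *] .
    qed
    then show ?thesis by (auto simp: parcs_mk_symmetric C)
  qed
  show "connected_set (parcs G) (verts C)"
    unfolding connected_set_def
  proof (intro ballI)
    fix a b assume "a \<in> verts C" "b \<in> verts C"
    then have "(a, b) \<in> rtrancl_on (verts C) (parcs (mk_symmetric C))"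
      using conn by (auto simp: connected_def strongly_connected_def reachable_def)
    then have "(a, b) \<in> (parcs (mk_symmetric C))\<^sup>*" by (rule rtrancl_on_rtranclI)
    then show "(a, b) \<in> (parcs G \<inter> verts C \<times> verts C)\<^sup>*" using rtrancl_mono[OF arcs] by blast
  qed
qed

lemma fcov_le:
  assumes "fractional_cover \<F> S y"
  shows "fcov \<F> S \<le> (\<Sum>A\<in>\<F>. y A)"
  unfolding fcov_def
proof (rule cInf_lower)
  show "bdd_below {\<Sum>A\<in>\<F>. y A |y. fractional_cover \<F> S y}"
    by (intro bdd_belowI[of _ 0]) (auto simp: fractional_cover_def intro!: sum_nonneg)
qed (use assms in blast)

text \<open>Reachability in the digraph is confined to its vertices; arcs never leave them, so from
  a vertex it is the plain closure.\<close>

lemma descendants_eq: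
  fixes G :: "'a pair_pre_digraph"
  assumes "pair_graph G" "u \<in> pverts G"
  shows "descendants G Ls u = (parcs (layer_digraph G Ls))\<^sup>* `` {u}"
proof -
  interpret pair_graph G by fact
  let ?R = "parcs (layer_digraph G Ls)"
  have R: "b \<in> pverts G" if "(a, b) \<in> ?R" for a b
    using that in_arcsD2 by (auto simp: layer_digraph_def)
  have "v \<in> pverts G" if "(u, v) \<in> ?R\<^sup>*" for v
    using that by induction (use assms R in auto)
  then have "(u, v) \<in> rtrancl_on (pverts G) ?R \<longleftrightarrow> (u, v) \<in> ?R\<^sup>*" for v
    using rtrancl_consistent_rtrancl_on[of u v ?R "pverts G"] assms R rtrancl_on_rtranclI by metis
  then show ?thesis
    by (auto simp: descendants_def reachable_def layer_digraph_def)
qed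

theorem theorem6p1:
  fixes G :: "'a pair_pre_digraph" and Ls :: "'a set list" and \<F> :: "'a set set"
    and n k :: nat and X :: "'a set" and f :: real
  assumes "pair_graph G" and "n = card (pverts G)"
    and "k > 0"
    and "ordered_partition (pverts G) Ls"
    and "\<F> = layered_family G Ls"
    and "thickness Ls \<F> \<le> k"
    and "X \<subseteq> layer_centers G Ls"
    and "f = separator_lp_opt G \<F> X"
  shows "\<exists>S. balanced_separator G X (95 / 100) S \<and> downward_closed G Ls S \<and>
           fcov \<F> S \<le> 5000 * real k * log 2 (2 * real n) * log 2 (f + 4) * f"
proof -
  interpret pair_graph G by fact
  let ?V = "pverts G" and ?E = "parcs G" and ?R = "parcs (layer_digraph G Ls)"
  \<comment> \<open>Members are bare sets, so their centers are recovered by choice.\<close>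
  define cen where "cen A = (SOME c. c \<in> layer_centers G Ls \<and> descendants G Ls c = A)" for A
  have cen: "cen A \<in> layer_centers G Ls" "descendants G Ls (cen A) = A" if "A \<in> \<F>" for A
    using someI_ex[of "\<lambda>c. c \<in> layer_centers G Ls \<and> descendants G Ls c = A"] that assms(5)
    unfolding cen_def[symmetric] by (auto simp: layered_family_def)
  have centers_V: "layer_centers G Ls \<subseteq> ?V" by (auto simp: layer_centers_def)
  interpret cone_family ?V ?E ?R \<F> cen
  proof
    show "?E \<subseteq> ?V \<times> ?V" using in_arcsD1 in_arcsD2 by auto
    show "sym ?E" using sym_arcs by (simp add: symmetric_def)
    show "?R \<subseteq> ?E" by (auto simp: layer_digraph_def)
    show "finite \<F>" using finite_layered_family assms by blast
    show "cen A \<in> ?V" if "A \<in> \<F>" for A using cen that centers_V by blast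
    show "A = ?R\<^sup>* `` {cen A}" if "A \<in> \<F>" for A
      using cen[OF that] descendants_eq[OF assms(1)] centers_V by blast
    show "?V \<subseteq> \<Union> \<F>" using layered_family_covers assms by blast
    have "card \<F> \<le> card (layer_centers G Ls)"
      using assms centers_V finite_subset[OF centers_V] by (auto simp: layered_family_def intro: card_image_le)
    also have "\<dots> \<le> card ?V" using centers_V by (intro card_mono) auto
    finally show "card \<F> \<le> card ?V" .
  qed simp
  obtain x d where lp: "separator_lp_feasible G \<F> X x d" and xf: "(\<Sum>A\<in>\<F>. x A) = f"
    using separator_lp_opt_attained[OF finite_F covers, of X] assms(8) by blast
  have x0: "0 \<le> x A" if "A \<in> \<F>" for A using lp that by (auto simp: separator_lp_feasible_def)
  \<comment> \<open>The program constrains induced paths only. A connected set contains such a path,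
    and the path meets no more members than the set.\<close>
  have dmass: "d u v \<le> mass x B"
    if B: "connected_set ?E B" "B \<subseteq> ?V" "u \<in> B \<inter> X" "v \<in> B \<inter> X" for B u v
  proof -
    obtain P where P: "induced_path G u v P" "set P \<subseteq> B" using exists_induced_path[OF B(1,2)] B by blast
    then have "d u v \<le> mass x (set P)"
      using lp B unfolding separator_lp_feasible_def mass_def by blast
    also have "\<dots> \<le> mass x B" using x0 P(2) by (rule mass_mono)
    finally show ?thesis .
  qed
  have XV: "X \<subseteq> ?V" using assms(7) centers_V by blast
  have d1: "d u v \<le> 1" if "u \<in> X" "v \<in> X" for u v
    using lp that by (simp add: separator_lp_feasible_def)
  have dsum: "real (card X) / 10 \<le> (\<Sum>v\<in>X. d u v)" if "u \<in> X" for u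
    using lp that by (simp add: separator_lp_feasible_def)
  obtain S y where S: "closed_set S" "\<forall>B. B \<subseteq> ?V - S \<longrightarrow> \<not> big X B" and y: "fractional_cover \<F> S y"
    "(\<Sum>A\<in>\<F>. y A) \<le> 3648 * log 2 (2 * real n) * log 2 (f + 4) * f"
    by (rule exists_closed_separator[where d = d and x = x, OF XV d1 dsum dmass x0, unfolded xf, folded assms(2)])
      blast
  show ?thesis
  proof (intro exI[of _ S] conjI)
    show "balanced_separator G X (95 / 100) S"
      unfolding balanced_separator_def
    proof (intro conjI allI impI)
      show "S \<subseteq> ?V" using S by (simp add: closed_set_def)
      fix C assume "is_component (with_proj G \<restriction> (?V - S)) C"
      note C = connected_set_component[OF assms(1) this]
      then have "\<not> big X (verts C)" using S(2) by blast
      then show "real (card (verts C \<inter> X)) \<le> 95 / 100 * real (card X)"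
        using C(1) by (simp add: big_def)
    qed
    show "downward_closed G Ls S"
      unfolding downward_closed_def
    proof (intro ballI subsetI)
      fix u v assume u: "u \<in> S" "v \<in> descendants G Ls u"
      then have "(u, v) \<in> ?R\<^sup>*"
        using descendants_eq[OF assms(1)] S(1) by (auto simp: closed_set_def)
      then show "v \<in> S" by induction (use u S(1) in \<open>auto simp: closed_set_def\<close>)
    qed
    have f0: "0 \<le> f" using xf x0 sum_nonneg by metis
    then have "0 \<le> log 2 (f + 4) * f" by simp
    moreover have "0 \<le> log 2 (2 * real n)"
    proof (cases "n = 0")
      case True
      then show ?thesis by (simp add: log_def)
    qed simp
    ultimately have nn: "0 \<le> log 2 (2 * real n) * (log 2 (f + 4) * f)" by (rule mult_nonneg_nonneg[rotated])
    have "fcov \<F> S \<le> 3648 * log 2 (2 * real n) * log 2 (f + 4) * f" using fcov_le[OF y(1)] y(2) by simp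
    also have "\<dots> = 3648 * (log 2 (2 * real n) * (log 2 (f + 4) * f))" by simp
    \<comment> \<open>Here k \<ge> 1 gives 3648 \<le> 5000 k; the remaining factor is nonnegative,
      also for n = 0.\<close>
    also have "\<dots> \<le> (5000 * real k) * (log 2 (2 * real n) * (log 2 (f + 4) * f))"
      using assms(3) nn by (intro mult_right_mono) auto
    finally show "fcov \<F> S \<le> 5000 * real k * log 2 (2 * real n) * log 2 (f + 4) * f"
      by (simp add: mult.assoc)
  qed
qed

end
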